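(* Let $F$ be holomorphic in a neighborhood of zero with $F(0)=0$ and $F'(0)\neq0$, and let $G=F^{-1}$ be its local inverse near zero. Write $F(z)=\sum_{k=1}^{\infty}a_kz^k$ and $G(z)=\sum_{k=1}^{\infty}b_kz^k$, so that $b_1=\frac{1}{a_1}=:b$. Then $$b_n=-b^n\sum_{k=1}^{n-1}b_kB_{n,k}^o(a_1,\ldots,a_{n-k+1}),\quad n\ge2.$$ Consequently, for every $\lambda\in\mathbb{C}$, $\Phi_1(G,\lambda)=-b^6\Phi_1(F,2-\lambda)$ and $$\Phi_2(G,\lambda)=b^{8}\Phi_2(F,\lambda)+(4\lambda-5)b^{10}a_2^2\Phi_1(F).$$
   Context: For $1\le k\le n$ the ordinary Bell polynomials are $$B^o_{n,k}(x_{1},x_{2},\dots ,x_{n-k+1})=k!\sum_{j \in I_k}\prod_{i=1}^{n-k+1} \frac{x_i^{j_{i}} }{j_{i}!},$$ where $I_k$ consists of all multi-indices $j=(j_1,\ldots,j_{n-k+1})$ of non-negative integers with $\sum_{i=1}^{n-k+1} i j_i=n$ and $\sum_{i=1}^{n-k+1} j_i=k$. For $f(z)=\sum_{k=0}^\infty f_kz^k$ holomorphic near zero, $\lambda\in\mathbb{C}$ and $n=0,1,2,\ldots$, $\Phi_n(f,\lambda):=f_nf_{n+2}-\lambda f_{n+1}^2$ and $\Phi_n(f):=\Phi_n(f,1)$. *)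

theory Defs
  imports "HOL-Complex_Analysis.Complex_Analysis"
begin

definition bell_indices :: "nat \<Rightarrow> nat \<Rightarrow> (nat \<Rightarrow> nat) set" where
  "bell_indices n k =
     {j \<in> {1..n - k + 1} \<rightarrow>\<^sub>E UNIV.
        (\<Sum>i = 1..n - k + 1. i * j i) = n \<and> (\<Sum>i = 1..n - k + 1. j i) = k}"

text \<open>Intended for \<open>1 \<le> k \<le> n\<close>, where the truncated subtraction \<open>n - k\<close> is harmless.
  The arguments \<open>x\<^sub>1, \<dots>, x\<^sub>n\<^sub>-\<^sub>k\<^sub>+\<^sub>1\<close> are passed as a sequence, of which no other entries are used.\<close>

definition ordinary_bell :: "nat \<Rightarrow> nat \<Rightarrow> (nat \<Rightarrow> complex) \<Rightarrow> complex" where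
  "ordinary_bell n k x =
     fact k * (\<Sum>j\<in>bell_indices n k. \<Prod>i = 1..n - k + 1. x i ^ j i / fact (j i))"

lemma finite_bell_indices: "finite (bell_indices n k)"
proof (rule finite_subset)
  show "bell_indices n k \<subseteq> {1..n - k + 1} \<rightarrow>\<^sub>E {..k}"
  proof
    fix j assume j: "j \<in> bell_indices n k"
    have "j i \<le> k" if "i \<in> {1..n - k + 1}" for i
    proof -
      have "j i \<le> (\<Sum>i = 1..n - k + 1. j i)"
        by (rule member_le_sum) (use that in auto)
      with j show ?thesis by (simp add: bell_indices_def)
    qed
    with j show "j \<in> {1..n - k + 1} \<rightarrow>\<^sub>E {..k}"
      by (auto simp: bell_indices_def PiE_iff)
  qed
  show "finite ({1..n - k + 1} \<rightarrow>\<^sub>E {..k})"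
    by (intro finite_PiE) auto
qed

definition taylor_coeff :: "(complex \<Rightarrow> complex) \<Rightarrow> nat \<Rightarrow> complex" where
  "taylor_coeff f n = fps_nth (fps_expansion f 0) n"

definition Phi :: "nat \<Rightarrow> (complex \<Rightarrow> complex) \<Rightarrow> complex \<Rightarrow> complex" where
  "Phi n f l = taylor_coeff f n * taylor_coeff f (n + 2) - l * (taylor_coeff f (n + 1))\<^sup>2"

abbreviation Phi_one :: "nat \<Rightarrow> (complex \<Rightarrow> complex) \<Rightarrow> complex" where
  "Phi_one n f \<equiv> Phi n f 1"

text \<open>No regularity of \<open>g\<close> is required: when \<open>f\<close> is holomorphic near \<open>p\<close>, its injectivity on
  \<open>U\<close> makes \<open>g\<close> holomorphic near \<open>f p\<close>.\<close>

definition local_inverse_at ::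
    "(complex \<Rightarrow> complex) \<Rightarrow> (complex \<Rightarrow> complex) \<Rightarrow> complex \<Rightarrow> bool" where
  "local_inverse_at f g p \<longleftrightarrow>
     (\<exists>U V. open U \<and> p \<in> U \<and> open V \<and> bij_betw f U V \<and> (\<forall>z\<in>U. g (f z) = z))"

end

theory Submission
  imports Defs
begin

text \<open>
  On the level of formal power series, \<open>G \<circ> F = id\<close> says that
  \<open>\<Sum>\<^sub>k b\<^sub>k (F^k)\<^sub>n\<close> vanishes for \<open>n \<ge> 2\<close>, where \<open>(F^k)\<^sub>n\<close> is the \<open>n\<close>-th coefficient of the
  \<open>k\<close>-th power. Since \<open>F\<close> has no constant term, only \<open>k \<le> n\<close> contributes, and the term
  \<open>k = n\<close> is \<open>b\<^sub>n a\<^sub>1^n\<close>; solving for it expresses \<open>b\<^sub>n\<close> through \<open>b\<^sub>1, \<dots>, b\<^sub>n\<^sub>-\<^sub>1\<close>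
  (\<open>fps_left_inverse_recurrence\<close>).

  The ordinary Bell polynomials enter because \<open>(F^k)\<^sub>n\<close> is exactly \<open>B\<^sup>o\<^sub>n\<^sub>,\<^sub>k(a\<^sub>1, \<dots>)\<close>
  (\<open>fps_power_nth_eq_ordinary_bell\<close>): a factor \<open>z^k\<close> comes out of \<open>F^k\<close>, so that only
  \<open>a\<^sub>1, \<dots>, a\<^sub>n\<^sub>-\<^sub>k\<^sub>+\<^sub>1\<close> matter, and the multinomial theorem for the \<open>k\<close>-th power of the polynomial
  \<open>a\<^sub>1 z + \<dots> + a\<^sub>n\<^sub>-\<^sub>k\<^sub>+\<^sub>1 z^(n-k+1)\<close> produces one monomial for each multi-index, whose degree is \<open>n\<close> precisely for those in
  the definition of \<open>B\<^sup>o\<^sub>n\<^sub>,\<^sub>k\<close>.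

  Analytically, injectivity of \<open>F\<close> makes \<open>G\<close> holomorphic near zero
  (\<open>analytic_local_inverse\<close>), so that both functions are the sums of their Taylor series there, and
  uniqueness of Taylor coefficients turns \<open>G \<circ> F = id\<close> into the formal identity. Once
  \<open>b\<^sub>2, b\<^sub>3, b\<^sub>4\<close> are known explicitly, the two formulas for \<open>\<Phi>\<^sub>1\<close> and \<open>\<Phi>\<^sub>2\<close> are polynomial
  identities modulo the relation \<open>b a\<^sub>1 = 1\<close>.
\<close>

section \<open>The multinomial theorem for formal power series\<close>

lemma finite_PiE_sum_eq:
  assumes "finite S"
  shows "finite {j. j \<in> S \<rightarrow>\<^sub>E (UNIV :: nat set) \<and> (\<Sum>i\<in>S. j i) = k}"
proof (rule finite_subset)
  show "{j. j \<in> S \<rightarrow>\<^sub>E (UNIV :: nat set) \<and> (\<Sum>i\<in>S. j i) = k} \<subseteq> S \<rightarrow>\<^sub>E {..k}"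
  proof
    fix j assume j: "j \<in> {j. j \<in> S \<rightarrow>\<^sub>E (UNIV :: nat set) \<and> (\<Sum>i\<in>S. j i) = k}"
    have "j i \<le> (\<Sum>i\<in>S. j i)" if "i \<in> S" for i
      using that assms by (intro member_le_sum) auto
    with j show "j \<in> S \<rightarrow>\<^sub>E {..k}"
      by (auto simp: PiE_iff)
  qed
  show "finite (S \<rightarrow>\<^sub>E {..k})"
    using assms by (intro finite_PiE) auto
qed

text \<open>
  In terms of the divided powers \<open>u^k / k!\<close> the multinomial theorem carries no coefficients, and
  the induction step is just the binomial theorem. Functions on \<open>insert a S\<close> with sum \<open>k\<close>
  are split into their value \<open>m\<close> at \<open>a\<close> and their restriction to \<open>S\<close>, whose sum is \<open>k - m\<close>.
\<close>

lemma fps_multinomial: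
  fixes u :: "'i \<Rightarrow> 'a :: field_char_0 fps"
  assumes "finite S"
  shows "fps_const (1 / fact k) * (\<Sum>i\<in>S. u i) ^ k =
         (\<Sum>j | j \<in> S \<rightarrow>\<^sub>E UNIV \<and> (\<Sum>i\<in>S. j i) = k.
            \<Prod>i\<in>S. fps_const (1 / fact (j i)) * u i ^ j i)"
  using assms
proof (induction S arbitrary: k rule: finite_induct)
  case empty
  show ?case
  proof (cases "k = 0")
    case True
    have "{j. j \<in> {} \<rightarrow>\<^sub>E (UNIV :: nat set) \<and> (\<Sum>i\<in>{}. j i) = 0} = {\<lambda>_::'i. undefined}"
      by auto
    with True show ?thesis by simp
  qed (auto simp: power_0_left)
next
  case (insert a S)
  let ?d = "\<lambda>m. fps_const (1 / fact m) :: 'a fps"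
  let ?P = "\<Sum>i\<in>S. u i"
  let ?E = "\<lambda>k. {j. j \<in> S \<rightarrow>\<^sub>E (UNIV :: nat set) \<and> (\<Sum>i\<in>S. j i) = k}"
  let ?E' = "{j. j \<in> insert a S \<rightarrow>\<^sub>E (UNIV :: nat set) \<and> (\<Sum>i\<in>insert a S. j i) = k}"
  let ?t = "\<lambda>A j. \<Prod>i\<in>A. ?d (j i) * u i ^ j i"
  have fin: "finite (?E m)" for m
    using insert.hyps(1) by (rule finite_PiE_sum_eq)
  have divided_binomial: "?d k * of_nat (k choose m) = ?d m * ?d (k - m)" if "m \<le> k" for m
    using that by (simp add: fps_of_nat[symmetric] binomial_fact del: fps_of_nat)
  have "?d k * (\<Sum>i\<in>insert a S. u i) ^ k = ?d k * (u a + ?P) ^ k"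
    using insert.hyps by simp
  also have "\<dots> = (\<Sum>m\<le>k. ?d k * of_nat (k choose m) * u a ^ m * ?P ^ (k - m))"
    by (simp add: binomial_ring sum_distrib_left mult.assoc)
  also have "\<dots> = (\<Sum>m\<le>k. (?d m * u a ^ m) * (?d (k - m) * ?P ^ (k - m)))"
    by (intro sum.cong refl) (simp only: divided_binomial atMost_iff, simp only: mult_ac)
  also have "\<dots> = (\<Sum>m\<le>k. \<Sum>g\<in>?E (k - m). (?d m * u a ^ m) * ?t S g)"
    by (simp only: insert.IH sum_distrib_left)
  also have "\<dots> = (\<Sum>(m, g)\<in>Sigma {..k} (\<lambda>m. ?E (k - m)). (?d m * u a ^ m) * ?t S g)"
    by (rule sum.Sigma) (use fin in auto)
  also have "\<dots> = (\<Sum>j\<in>?E'. ?t (insert a S) j)"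
  proof (rule sum.reindex_bij_witness
      [where i = "\<lambda>j. (j a, restrict j S)" and j = "\<lambda>(m, g). g(a := m)"])
    have upd: "(\<Sum>i\<in>S. (g(a := m)) i) = (\<Sum>i\<in>S. g i)"
      "?t S (g(a := m)) = ?t S g" for g m
      using insert.hyps(2) by (auto intro!: sum.cong prod.cong)
    fix p assume p: "p \<in> Sigma {..k} (\<lambda>m. ?E (k - m))"
    obtain m g where [simp]: "p = (m, g)" by force
    have g: "m \<le> k" "g \<in> S \<rightarrow>\<^sub>E UNIV" "(\<Sum>i\<in>S. g i) = k - m"
      using p by auto
    have "restrict (g(a := m)) S = g"
      using g(2) insert.hyps(2) by (auto simp: restrict_def fun_eq_iff PiE_iff extensional_def)
    then show "(\<lambda>j. (j a, restrict j S)) ((\<lambda>(m, g). g(a := m)) p) = p"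
      by simp
    show "(\<lambda>(m, g). g(a := m)) p \<in> ?E'"
      using g insert.hyps upd(1)[of g m] by (auto simp: PiE_iff extensional_def)
    show "?t (insert a S) ((\<lambda>(m, g). g(a := m)) p) =
        (case p of (m, g) \<Rightarrow> (?d m * u a ^ m) * ?t S g)"
      using insert.hyps upd(2)[of g m] by simp
  next
    fix j assume j: "j \<in> ?E'"
    show "(\<lambda>(m, g). g(a := m)) (j a, restrict j S) = j"
      using j by (auto simp: fun_eq_iff PiE_iff extensional_def)
    show "(j a, restrict j S) \<in> Sigma {..k} (\<lambda>m. ?E (k - m))"
      using j insert.hyps by auto
  qed
  finally show ?case .
qed

section \<open>Ordinary Bell polynomials as coefficients of powers\<close>

lemma fps_power_nth_cong:
  fixes A B :: "'a :: comm_semiring_1 fps"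
  assumes "\<And>i. i \<le> m \<Longrightarrow> fps_nth A i = fps_nth B i" and "n \<le> m"
  shows "fps_nth (A ^ k) n = fps_nth (B ^ k) n"
  using assms(2)
proof (induction k arbitrary: n)
  case (Suc k)
  then show ?case
    by (simp add: fps_mult_nth assms(1))
qed simp

text \<open>
  After division of \<open>A^k\<close> by \<open>z^k\<close>, the \<open>n\<close>-th coefficient becomes the one of index \<open>n - k\<close> in the
  \<open>k\<close>-th power of \<open>A / z\<close>. This is why \<open>A\<close> may be cut off after the degree \<open>n - k + 1\<close>.
\<close>

lemma fps_power_nth_truncate:
  fixes A :: "'a :: comm_ring_1 fps"
  assumes "fps_nth A 0 = 0" and "k \<le> n"
  shows "fps_nth (A ^ k) n =
         fps_nth ((\<Sum>i = 1..n - k + 1. fps_const (fps_nth A i) * fps_X ^ i) ^ k) n"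
proof -
  define N where "N = n - k + 1"
  define T where "T = (\<Sum>i = 1..N. fps_const (fps_nth A i) * fps_X ^ i)"
  have T_nth: "fps_nth T i = (if i \<in> {1..N} then fps_nth A i else 0)" for i
    unfolding T_def by (simp add: fps_sum_nth fps_X_power_nth mult_delta_right)
  have shift: "fps_X * fps_shift 1 B = B" if "fps_nth B 0 = 0" for B :: "'a fps"
    using that by (intro fps_ext) auto
  have pow: "fps_nth (B ^ k) n = fps_nth (fps_shift 1 B ^ k) (n - k)"
    if "fps_nth B 0 = 0" for B :: "'a fps"
  proof -
    have "B ^ k = fps_X ^ k * fps_shift 1 B ^ k"
      by (subst shift[OF that, symmetric]) (rule power_mult_distrib)
    then show ?thesis
      using assms(2) by (simp add: fps_X_power_mult_nth)
  qed
  have "fps_nth (fps_shift 1 A ^ k) (n - k) = fps_nth (fps_shift 1 T ^ k) (n - k)"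
    by (rule fps_power_nth_cong[where m = "n - k"]) (auto simp: T_nth N_def)
  then have "fps_nth (A ^ k) n = fps_nth (T ^ k) n"
    using assms(1) by (simp add: pow T_nth)
  then show ?thesis
    by (simp add: T_def N_def)
qed

theorem fps_power_nth_eq_ordinary_bell:
  assumes "fps_nth A 0 = 0" and "k \<le> n"
  shows "fps_nth (A ^ k) n = ordinary_bell n k (fps_nth A)"
proof -
  let ?N = "n - k + 1"
  let ?u = "\<lambda>i. fps_const (fps_nth A i) * fps_X ^ i"
  let ?E = "{j. j \<in> {1..?N} \<rightarrow>\<^sub>E (UNIV :: nat set) \<and> (\<Sum>i = 1..?N. j i) = k}"
  let ?c = "\<lambda>j. \<Prod>i = 1..?N. fps_nth A i ^ j i / fact (j i)"
  have fin: "finite ?E"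
    by (rule finite_PiE_sum_eq) simp
  \<comment> \<open>Extraction of the \<open>n\<close>-th coefficient hence becomes the weight condition on the multi-index.\<close>
  have monomial: "(\<Prod>i = 1..?N. fps_const (1 / fact (j i)) * ?u i ^ j i) =
      fps_const (?c j) * fps_X ^ (\<Sum>i = 1..?N. i * j i)" for j :: "nat \<Rightarrow> nat"
  proof -
    have "fps_const (1 / fact (j i)) * ?u i ^ j i =
        fps_const (fps_nth A i ^ j i / fact (j i)) * fps_X ^ (i * j i)" for i
      by (simp add: power_mult_distrib fps_const_power power_mult mult.assoc[symmetric])
    moreover have "(\<Prod>i\<in>S. fps_const (c i)) = fps_const (\<Prod>i\<in>S. c i)"
      for S :: "nat set" and c :: "nat \<Rightarrow> complex"
      by (induction S rule: infinite_finite_induct) auto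
    ultimately show ?thesis
      by (simp only: prod.distrib power_sum)
  qed
  have "fps_nth (A ^ k) n = fps_nth ((\<Sum>i = 1..?N. ?u i) ^ k) n"
    using assms by (rule fps_power_nth_truncate)
  also have "\<dots> = fact k * fps_nth (fps_const (1 / fact k) * (\<Sum>i = 1..?N. ?u i) ^ k) n"
    by simp
  also have "fps_const (1 / fact k) * (\<Sum>i = 1..?N. ?u i) ^ k =
      (\<Sum>j\<in>?E. fps_const (?c j) * fps_X ^ (\<Sum>i = 1..?N. i * j i))"
    by (simp only: fps_multinomial[OF finite_atLeastAtMost] monomial)
  also have "fps_nth \<dots> n = (\<Sum>j\<in>?E. if (\<Sum>i = 1..?N. i * j i) = n then ?c j else 0)"
    by (auto simp: fps_sum_nth fps_X_power_nth intro!: sum.cong)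
  also have "\<dots> = (\<Sum>j\<in>bell_indices n k. ?c j)"
    by (simp only: sum.inter_filter[OF fin, symmetric]) (auto simp: bell_indices_def intro!: sum.cong)
  finally show ?thesis
    by (simp add: ordinary_bell_def)
qed

section \<open>Coefficients of a compositional inverse\<close>

lemma fps_left_inverse_nth_1:
  fixes A B :: "'a :: field fps"
  assumes "fps_nth A 0 = 0" and "fps_compose B A = fps_X"
  shows "fps_nth B 1 * fps_nth A 1 = 1"
  using arg_cong[OF assms(2), of "\<lambda>f. fps_nth f 1"] by (simp add: fps_compose_nth)

lemma fps_left_inverse_recurrence:
  fixes A B :: "'a :: field fps"
  assumes A0: "fps_nth A 0 = 0" and BA: "fps_compose B A = fps_X" and n: "n \<ge> 2"
  shows "fps_nth B n =
         - ((1 / fps_nth A 1) ^ n) * (\<Sum>k = 1..n - 1. fps_nth B k * fps_nth (A ^ k) n)"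
proof -
  let ?S = "\<Sum>k = 1..n - 1. fps_nth B k * fps_nth (A ^ k) n"
  have A1: "fps_nth A 1 \<noteq> 0"
    using fps_left_inverse_nth_1[OF A0 BA] by auto
  have ivl: "{0..n} = insert 0 (insert n {1..n - 1})"
    using n by auto
  have "0 = fps_nth (fps_compose B A) n"
    using n by (simp add: BA)
  also have "\<dots> = (\<Sum>k\<in>{0..n}. fps_nth B k * fps_nth (A ^ k) n)"
    by (rule fps_compose_nth)
  also have "\<dots> = fps_nth B n * fps_nth A 1 ^ n + ?S"
    using n by (simp add: ivl startsby_zero_power_nth_same[OF A0])
  finally have "fps_nth B n * fps_nth A 1 ^ n = - ?S"
    by (simp add: eq_neg_iff_add_eq_0)
  with A1 show ?thesis
    by (simp add: field_simps)
qed

text \<open>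
  Substitution of the values of \<open>b\<^sub>1, \<dots>, b\<^sub>n\<^sub>-\<^sub>1\<close> into the recurrence; the relation
  \<open>\<beta> a\<^sub>1 = 1\<close> eliminates \<open>a\<^sub>1\<close>, which leaves polynomials in \<open>\<beta>, a\<^sub>2, a\<^sub>3, a\<^sub>4\<close>.
\<close>

lemma fps_left_inverse_nth_2_3_4:
  fixes A B :: "'a :: field fps"
  assumes A0: "fps_nth A 0 = 0" and BA: "fps_compose B A = fps_X"
  defines "a \<equiv> fps_nth A" and "\<beta> \<equiv> 1 / fps_nth A 1"
  shows "fps_nth B 2 = - (\<beta> ^ 3) * a 2"
    and "fps_nth B 3 = 2 * \<beta> ^ 5 * (a 2)\<^sup>2 - \<beta> ^ 4 * a 3"
    and "fps_nth B 4 = 5 * \<beta> ^ 6 * a 2 * a 3 - \<beta> ^ 5 * a 4 - 5 * \<beta> ^ 7 * a 2 ^ 3"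
proof -
  have B1: "fps_nth B 1 = \<beta>" and \<beta>a: "\<beta> * a 1 = 1"
    using fps_left_inverse_nth_1[OF A0 BA] by (auto simp: \<beta>_def a_def eq_divide_eq)
  note rec = fps_left_inverse_recurrence[OF A0 BA, folded \<beta>_def]
  have ivl: "{Suc 0..2} = {Suc 0, 2}" "{Suc 0..3} = {Suc 0, 2, 3}"
    by auto
  have powers: "fps_nth (A ^ 2) 3 = 2 * a 1 * a 2"
    "fps_nth (A ^ 2) 4 = 2 * a 1 * a 3 + (a 2)\<^sup>2"
    "fps_nth (A ^ 3) 4 = 3 * (a 1)\<^sup>2 * a 2"
    using A0
    by (simp_all add: a_def fps_mult_nth numeral_eq_Suc sum.atLeast0_atMost_Suc algebra_simps)
  show B2: "fps_nth B 2 = - (\<beta> ^ 3) * a 2"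
    using rec[of 2] by (simp add: B1[simplified] a_def power2_eq_square power3_eq_cube)
  show B3: "fps_nth B 3 = 2 * \<beta> ^ 5 * (a 2)\<^sup>2 - \<beta> ^ 4 * a 3"
  proof -
    have "fps_nth B 3 = - (\<beta> ^ 3) * (\<beta> * a 3 + - (\<beta> ^ 3) * a 2 * (2 * a 1 * a 2))"
      using rec[of 3] by (simp add: ivl B1[simplified] B2 powers) (simp add: a_def)
    with \<beta>a show ?thesis by algebra
  qed
  have "fps_nth B 4 = - (\<beta> ^ 4) * (\<beta> * a 4 + - (\<beta> ^ 3) * a 2 * (2 * a 1 * a 3 + (a 2)\<^sup>2)
      + (2 * \<beta> ^ 5 * (a 2)\<^sup>2 - \<beta> ^ 4 * a 3) * (3 * (a 1)\<^sup>2 * a 2))"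
    using rec[of 4] by (simp add: ivl B1[simplified] B2 B3 powers add.assoc) (simp add: a_def)
  with \<beta>a show "fps_nth B 4 = 5 * \<beta> ^ 6 * a 2 * a 3 - \<beta> ^ 5 * a 4 - 5 * \<beta> ^ 7 * a 2 ^ 3"
    by algebra
qed

section \<open>Holomorphic local inverses\<close>

text \<open>
  The set on which \<open>f\<close> is known to be injective is shrunk to one on which it is also holomorphic;
  its image is open by the open mapping theorem, and there \<open>g\<close> coincides with the holomorphic
  inverse.
\<close>

lemma analytic_local_inverse:
  assumes "f analytic_on {p}" and "local_inverse_at f g p"
  shows "g analytic_on {f p}" and "\<forall>\<^sub>F z in nhds p. g (f z) = z"
proof -
  obtain U V where U: "open U" "p \<in> U" "bij_betw f U V" "\<And>z. z \<in> U \<Longrightarrow> g (f z) = z"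
    using assms(2) unfolding local_inverse_at_def by blast
  obtain W where W: "open W" "p \<in> W" "f holomorphic_on W"
    using assms(1) by (auto simp: analytic_at)
  define S where "S = U \<inter> W"
  have S: "open S" "p \<in> S" "f holomorphic_on S" "inj_on f S"
    using U W by (auto simp: S_def bij_betw_def intro: holomorphic_on_subset inj_on_subset)
  obtain h where h: "h holomorphic_on (f ` S)" "\<And>z. z \<in> S \<Longrightarrow> h (f z) = z"
    using holomorphic_has_inverse[OF S(3,1,4)] by metis
  have "g holomorphic_on (f ` S)"
    using h U(4) by (auto simp: S_def intro: holomorphic_transform)
  moreover have "open (f ` S)"
    using S by (intro open_mapping_thm3)
  ultimately show "g analytic_on {f p}"
    using S(2) by (auto simp: analytic_at)
  show "\<forall>\<^sub>F z in nhds p. g (f z) = z"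
    using U by (auto simp: eventually_nhds)
qed

lemma eventually_taylor_sums_without_constant:
  assumes "f analytic_on {0}" and "f 0 = 0"
  shows "\<forall>\<^sub>F z in nhds 0. (\<lambda>k. taylor_coeff f (Suc k) * z ^ Suc k) sums f z"
proof -
  obtain S where S: "open S" "0 \<in> S" "f holomorphic_on S"
    using assms(1) by (auto simp: analytic_at)
  then obtain r where r: "r > 0" "ball 0 r \<subseteq> S"
    using openE by blast
  have hol: "f holomorphic_on eball 0 (ereal r)"
    using S(3) r(2) by (auto intro: holomorphic_on_subset)
  have "(\<lambda>k. taylor_coeff f (Suc k) * z ^ Suc k) sums f z" if "z \<in> ball 0 r" for z
  proof -
    have "(\<lambda>k. taylor_coeff f k * z ^ k) sums f z"
      using has_fps_expansion_imp_sums_complex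
        [OF analytic_at_imp_has_fps_expansion_0[OF assms(1)] hol, of z] that
      by (simp add: taylor_coeff_def)
    moreover have "taylor_coeff f 0 = 0"
      using assms(2) by (simp add: taylor_coeff_def fps_expansion_def)
    ultimately show ?thesis
      by (subst sums_Suc_iff) simp
  qed
  with r(1) show ?thesis
    by (intro eventually_nhds_in_open[THEN eventually_mono, of "ball 0 r"]) auto
qed

lemma fps_expansion_left_inverse:
  assumes f: "f analytic_on {0}" and g: "g analytic_on {0}" and f0: "f 0 = 0"
    and gf: "\<forall>\<^sub>F z in nhds 0. g (f z) = z"
  shows "fps_compose (fps_expansion g 0) (fps_expansion f 0) = fps_X"
proof (rule fps_expansion_unique_complex)
  have "fps_nth (fps_expansion f 0) 0 = 0"
    using f0 by (simp add: fps_expansion_def)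
  then show "(g \<circ> f) has_fps_expansion fps_compose (fps_expansion g 0) (fps_expansion f 0)"
    by (intro has_fps_expansion_compose analytic_at_imp_has_fps_expansion_0 f g)
  have "(g \<circ> f) has_fps_expansion fps_X \<longleftrightarrow> (\<lambda>z::complex. z) has_fps_expansion fps_X"
    using gf by (intro has_fps_expansion_cong) auto
  then show "(g \<circ> f) has_fps_expansion fps_X"
    by (simp add: has_fps_expansion_fps_X)
qed

section \<open>The coefficients of the local inverse\<close>

theorem lemma3p1:
  fixes F G :: "complex \<Rightarrow> complex" and a b :: "nat \<Rightarrow> complex" and \<beta> :: complex
  assumes F_holomorphic: "F analytic_on {0}"
    and F_zero: "F 0 = 0"
    and F_deriv: "deriv F 0 \<noteq> 0"
    and G_inverse: "local_inverse_at F G 0"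
    and a_def: "a = taylor_coeff F"
    and b_def: "b = taylor_coeff G"
    and beta_def: "\<beta> = 1 / a 1"
  shows "(\<forall>\<^sub>F z in nhds 0. (\<lambda>k. a (Suc k) * z ^ Suc k) sums F z) \<and>
         (\<forall>\<^sub>F z in nhds 0. (\<lambda>k. b (Suc k) * z ^ Suc k) sums G z) \<and>
         b 1 = \<beta> \<and>
         (\<forall>n\<ge>2. b n = - (\<beta> ^ n) * (\<Sum>k = 1..n - 1. b k * ordinary_bell n k a)) \<and>
         (\<forall>l. Phi 1 G l = - (\<beta> ^ 6) * Phi 1 F (2 - l)) \<and>
         (\<forall>l. Phi 2 G l =
                \<beta> ^ 8 * Phi 2 F l + (4 * l - 5) * \<beta> ^ 10 * (a 2)\<^sup>2 * Phi_one 1 F)"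
proof (intro conjI allI impI)
  let ?A = "fps_expansion F 0" and ?B = "fps_expansion G 0"
  have a: "a = fps_nth ?A" and b: "b = fps_nth ?B"
    by (auto simp: a_def b_def taylor_coeff_def fun_eq_iff)
  have G_analytic: "G analytic_on {0}" and GF: "\<forall>\<^sub>F z in nhds 0. G (F z) = z"
    using analytic_local_inverse[OF F_holomorphic G_inverse] by (simp_all add: F_zero)
  have G_zero: "G 0 = 0"
    using eventually_nhds_x_imp_x[OF GF] by (simp add: F_zero)
  show "\<forall>\<^sub>F z in nhds 0. (\<lambda>k. a (Suc k) * z ^ Suc k) sums F z"
    unfolding a_def using F_holomorphic F_zero by (rule eventually_taylor_sums_without_constant)
  show "\<forall>\<^sub>F z in nhds 0. (\<lambda>k. b (Suc k) * z ^ Suc k) sums G z"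
    unfolding b_def using G_analytic G_zero by (rule eventually_taylor_sums_without_constant)
  have A0: "fps_nth ?A 0 = 0"
    using F_zero by (simp add: fps_expansion_def)
  have BA: "fps_compose ?B ?A = fps_X"
    using F_holomorphic G_analytic F_zero GF by (rule fps_expansion_left_inverse)
  have ba: "b 1 * a 1 = 1"
    using fps_left_inverse_nth_1[OF A0 BA] by (simp add: a b)
  then show b1: "b 1 = \<beta>"
    by (auto simp: beta_def eq_divide_eq)
  show "b n = - (\<beta> ^ n) * (\<Sum>k = 1..n - 1. b k * ordinary_bell n k a)" if "n \<ge> 2" for n
  proof -
    have "b n = - (\<beta> ^ n) * (\<Sum>k = 1..n - 1. b k * fps_nth (?A ^ k) n)"
      using fps_left_inverse_recurrence[OF A0 BA that] by (simp add: a b beta_def)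
    also have "(\<Sum>k = 1..n - 1. b k * fps_nth (?A ^ k) n) =
        (\<Sum>k = 1..n - 1. b k * ordinary_bell n k a)"
      using fps_power_nth_eq_ordinary_bell[OF A0] by (intro sum.cong) (auto simp: a)
    finally show ?thesis .
  qed
  note b234 = fps_left_inverse_nth_2_3_4[OF A0 BA, folded a b, folded beta_def]
  have \<beta>a: "\<beta> * a 1 = 1"
    using ba b1 by simp
  have Phi_F: "Phi n F l = a n * a (n + 2) - l * (a (n + 1))\<^sup>2"
    and Phi_G: "Phi n G l = b n * b (n + 2) - l * (b (n + 1))\<^sup>2" for n l
    by (simp_all add: Phi_def a_def b_def)
  have index: "(1::nat) + 2 = 3" "(1::nat) + 1 = 2" "(2::nat) + 2 = 4" "(2::nat) + 1 = 3"
    by simp_all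
  fix l
  show "Phi 1 G l = - (\<beta> ^ 6) * Phi 1 F (2 - l)"
    unfolding Phi_F Phi_G index b1 b234 using \<beta>a by algebra
  show "Phi 2 G l = \<beta> ^ 8 * Phi 2 F l + (4 * l - 5) * \<beta> ^ 10 * (a 2)\<^sup>2 * Phi_one 1 F"
    unfolding Phi_F Phi_G index b1 b234 using \<beta>a by algebra
qed

end
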